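(* The set of all blossoms $\mathcal{B}_{b,t}$ in $G$ forms a laminar family: any two blossoms are either disjoint or one is contained in the other.
   Context: $G=(V,E)$ is a finite undirected graph with a matching $M$, with at least one unmatched vertex. Alternating paths are simple paths alternating between unmatched edges (not in $M$) and matched edges (in $M$), starting with an unmatched edge when starting at an unmatched vertex. $l_m$ is the minimum length of an augmenting path (alternating path between two distinct unmatched vertices), $\infty$ if none. $\mathrm{evenlevel}(v)$, $\mathrm{oddlevel}(v)$ are the minimum lengths of even, resp. odd, alternating paths from an unmatched vertex to $v$ ($\infty$ if none); such minimum paths are $\mathrm{evenlevel}(v)$, $\mathrm{oddlevel}(v)$ paths. Tenacity $t(v)=\mathrm{evenlevel}(v)+\mathrm{oddlevel}(v)$. A vertex is outer if $\mathrm{evenlevel}(v)<\mathrm{oddlevel}(v)$. For $t(v)=t<l_m$, $\mathrm{base}(v)$ is the vertex of tenacity $>t$ furthest from the starting unmatched vertex along any $\mathrm{evenlevel}(v)$ or $\mathrm{oddlevel}(v)$ path (known to be independent of the path). Blossoms: for an outer vertex $b$ and an odd number $t$ with $t<t(b)$ and $t<l_m$, $\mathcal{B}_{b,1}=\emptyset$, and for $t\ge3$, with $S_{b,t}=\{v: t(v)=t,\ \mathrm{base}(v)=b\}$, $\mathcal{B}_{b,t}=S_{b,t}\cup\bigcup_{v\in S_{b,t}\cup\{b\},\ v\text{ outer}}\mathcal{B}_{v,t-2}$. *)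

theory Defs
  imports Main "HOL-Library.Extended_Nat"
begin

text \<open>Graphs are simple and undirected: an edge is a two-element set of vertices.\<close>

locale matched_graph =
  fixes V :: "'a set" and E :: "'a set set" and M :: "'a set set"
  assumes finite_V: "finite V"
    and edges: "\<And>e. e \<in> E \<Longrightarrow> e \<subseteq> V \<and> card e = 2"
    and M_subset_E: "M \<subseteq> E"
    and matching: "\<And>e e'. e \<in> M \<Longrightarrow> e' \<in> M \<Longrightarrow> e \<noteq> e' \<Longrightarrow> e \<inter> e' = {}"
    and ex_unmatched: "\<exists>v \<in> V. v \<notin> \<Union>M"
begin

definition unmatched :: "'a \<Rightarrow> bool" where
  "unmatched v \<longleftrightarrow> v \<in> V \<and> v \<notin> \<Union>M"

text \<open>Paths are given by their vertex lists; \<open>[v]\<close> is the path of length 0 at \<open>v\<close>.\<close>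

definition simple_path :: "'a list \<Rightarrow> bool" where
  "simple_path p \<longleftrightarrow> p \<noteq> [] \<and> set p \<subseteq> V \<and> distinct p \<and>
     (\<forall>i. Suc i < length p \<longrightarrow> {p ! i, p ! Suc i} \<in> E)"

definition path_length :: "'a list \<Rightarrow> nat" where
  "path_length p = length p - 1"

definition alternating_path :: "'a list \<Rightarrow> bool" where
  "alternating_path p \<longleftrightarrow> simple_path p \<and>
     (\<forall>i. Suc (Suc i) < length p \<longrightarrow>
        ({p ! i, p ! Suc i} \<in> M \<longleftrightarrow> {p ! Suc i, p ! Suc (Suc i)} \<notin> M)) \<and>
     (unmatched (p ! 0) \<longrightarrow> 1 < length p \<longrightarrow> {p ! 0, p ! 1} \<notin> M)"

definition augmenting_path :: "'a list \<Rightarrow> bool" where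
  "augmenting_path p \<longleftrightarrow> alternating_path p \<and>
     unmatched (hd p) \<and> unmatched (last p) \<and> hd p \<noteq> last p"

text \<open>The infimum of the empty set in \<^typ>\<open>enat\<close> is \<open>\<infinity>\<close>.\<close>

definition l_m :: enat where
  "l_m = (INF p \<in> {p. augmenting_path p}. enat (path_length p))"

definition even_paths :: "'a \<Rightarrow> 'a list set" where
  "even_paths v = {p. alternating_path p \<and> unmatched (hd p) \<and> last p = v \<and> even (path_length p)}"

definition odd_paths :: "'a \<Rightarrow> 'a list set" where
  "odd_paths v = {p. alternating_path p \<and> unmatched (hd p) \<and> last p = v \<and> odd (path_length p)}"

definition evenlevel :: "'a \<Rightarrow> enat" where
  "evenlevel v = (INF p \<in> even_paths v. enat (path_length p))"

definition oddlevel :: "'a \<Rightarrow> enat" where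
  "oddlevel v = (INF p \<in> odd_paths v. enat (path_length p))"

definition evenlevel_path :: "'a \<Rightarrow> 'a list \<Rightarrow> bool" where
  "evenlevel_path v p \<longleftrightarrow> p \<in> even_paths v \<and> enat (path_length p) = evenlevel v"

definition oddlevel_path :: "'a \<Rightarrow> 'a list \<Rightarrow> bool" where
  "oddlevel_path v p \<longleftrightarrow> p \<in> odd_paths v \<and> enat (path_length p) = oddlevel v"

definition tenacity :: "'a \<Rightarrow> enat" where
  "tenacity v = evenlevel v + oddlevel v"

definition outer :: "'a \<Rightarrow> bool" where
  "outer v \<longleftrightarrow> evenlevel v < oddlevel v"

definition furthest_above :: "enat \<Rightarrow> 'a list \<Rightarrow> 'a \<Rightarrow> bool" where
  "furthest_above t p b \<longleftrightarrow>
     (\<exists>i < length p. p ! i = b \<and> t < tenacity b \<and>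
        (\<forall>j. i < j \<longrightarrow> j < length p \<longrightarrow> \<not> t < tenacity (p ! j)))"

text \<open>Only meaningful when \<open>tenacity v < l_m\<close>; the furthest vertex is then the same
  on all \<open>evenlevel(v)\<close> and \<open>oddlevel(v)\<close> paths.\<close>

definition base :: "'a \<Rightarrow> 'a" where
  "base v = (THE b. \<forall>p. evenlevel_path v p \<or> oddlevel_path v p \<longrightarrow>
     furthest_above (tenacity v) p b)"

definition S :: "'a \<Rightarrow> nat \<Rightarrow> 'a set" where
  "S b t = {v \<in> V. tenacity v = enat t \<and> base v = b}"

text \<open>Only meaningful for outer \<open>b\<close> and odd \<open>t\<close> with \<open>t < tenacity b\<close> and \<open>t < l_m\<close>;
  these conditions are inherited by the recursive calls.\<close>

fun blossom :: "'a \<Rightarrow> nat \<Rightarrow> 'a set" where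
  "blossom b t =
     (if t < 3 then {}
      else S b t \<union> (\<Union>v \<in> {v \<in> S b t \<union> {b}. outer v}. blossom v (t - 2)))"

declare blossom.simps [simp del]

definition blossoms :: "'a set set" where
  "blossoms = {blossom b t | b t.
     b \<in> V \<and> outer b \<and> odd t \<and> enat t < tenacity b \<and> enat t < l_m}"

end

end

theory Submission
  imports Defs
begin

text \<open>If \<open>v\<close> lies in \<open>blossom b t\<close>, then \<open>b\<close> is an iterated base of \<open>v\<close>, and the
  intermediate iterates lie in the blossom. Hence, if two blossoms with bases \<open>b\<close> and \<open>c\<close> share a
  vertex, either \<open>b = c\<close>, and they are nested by monotonicity in the tenacity, or one of the bases,
  say \<open>b\<close>, lies in the blossom of the other. In the latter case the tenacity of \<open>b\<close>
  exceeds that of its own blossom, so the recursion that puts \<open>b\<close> into the larger blossom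
  puts the whole blossom of \<open>b\<close> there.\<close>

context matched_graph
begin

lemma blossom_cases:
  assumes "v \<in> blossom b t"
  obtains "3 \<le> t" "v \<in> S b t"
    | w where "3 \<le> t" "w \<in> S b t" "outer w" "v \<in> blossom w (t - 2)"
    | "3 \<le> t" "outer b" "v \<in> blossom b (t - 2)"
  using assms by (subst (asm) blossom.simps) (auto split: if_splits)

lemma S_subset_blossom: "3 \<le> t \<Longrightarrow> S b t \<subseteq> blossom b t"
  by (subst blossom.simps) auto

lemma blossom_subset_blossom_base:
  "3 \<le> t \<Longrightarrow> w \<in> S b t \<Longrightarrow> outer w \<Longrightarrow> blossom w (t - 2) \<subseteq> blossom b t"
  by (subst (2) blossom.simps) auto

lemma blossom_minus_two_subset: "3 \<le> t \<Longrightarrow> outer b \<Longrightarrow> blossom b (t - 2) \<subseteq> blossom b t"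
  by (subst (2) blossom.simps) auto

text \<open>The recursion for an outer base includes its own blossom two levels down, so bounds of
  equal parity are joined by a chain of inclusions.\<close>

lemma blossom_mono:
  assumes "outer b" "odd s" "odd t" "s \<le> t"
  shows "blossom b s \<subseteq> blossom b t"
proof -
  have *: "blossom b s \<subseteq> blossom b (s + 2 * n)" for n
  proof (induction n)
    case (Suc n)
    \<comment> \<open>Oddness gives \<open>s \<ge> 1\<close>, which puts every step of the chain
      above the cutoff 3 of the recursion.\<close>
    have "3 \<le> s + 2 * Suc n" using \<open>odd s\<close> by (cases s) auto
    then have "blossom b (s + 2 * n) \<subseteq> blossom b (s + 2 * Suc n)"
      using blossom_minus_two_subset[OF _ \<open>outer b\<close>, of "s + 2 * Suc n"] by simp
    with Suc show ?case by blast
  qed simp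
  have "even (t - s)" using assms by simp
  then obtain n where "t - s = 2 * n" by (rule evenE)
  with \<open>s \<le> t\<close> have "t = s + 2 * n" by simp
  with * show ?thesis by simp
qed

text \<open>Descending through a vertex of \<open>S b t\<close> costs one application of
  \<open>base\<close>, descending through \<open>b\<close> itself costs none.\<close>

lemma base_iterates_in_blossom:
  assumes "v \<in> blossom b t"
  shows "\<exists>k>0. (base ^^ k) v = b \<and> (\<forall>j. 0 < j \<longrightarrow> j < k \<longrightarrow> (base ^^ j) v \<in> blossom b t)"
  using assms
proof (induction t arbitrary: b rule: less_induct)
  case (less t)
  from less.prems show ?case
  proof (cases rule: blossom_cases)
    case 1
    then have "(base ^^ 1) v = b" by (simp add: S_def)
    then show ?thesis by (intro exI[of _ 1]) auto
  next
    case (2 w)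
    obtain k where k: "0 < k" "(base ^^ k) v = w"
      "\<And>j. 0 < j \<Longrightarrow> j < k \<Longrightarrow> (base ^^ j) v \<in> blossom w (t - 2)"
      using less.IH[of "t - 2" w] 2 by auto
    have "(base ^^ Suc k) v = b"
      using k(2) \<open>w \<in> S b t\<close> by (simp add: S_def)
    \<comment> \<open>The only new intermediate iterate is \<open>w\<close> itself, at
      \<open>j = k\<close>.\<close>
    moreover have "(base ^^ j) v \<in> blossom b t" if "0 < j" "j < Suc k" for j
    proof (cases "j = k")
      case True
      then show ?thesis using k(2) S_subset_blossom 2 by blast
    next
      case False
      then show ?thesis using k(3)[of j] blossom_subset_blossom_base 2 that by force
    qed
    ultimately show ?thesis by blast
  next
    case 3
    then have "blossom b (t - 2) \<subseteq> blossom b t"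
      by (simp add: blossom_minus_two_subset)
    moreover have "t - 2 < t" using 3 by simp
    ultimately show ?thesis using less.IH[of "t - 2" b] 3(3) by blast
  qed
qed

text \<open>Unfolding the membership of \<open>c\<close> ends at a level equal to
  \<open>tenacity c\<close>, where the recursion also adds the blossom of \<open>c\<close> two
  levels down.\<close>

lemma blossom_subset_if_base_in_blossom:
  assumes "c \<in> blossom b t" "outer c" "odd s" "odd t" "enat s < tenacity c"
  shows "blossom c s \<subseteq> blossom b t"
  using assms(1,4)
proof (induction t arbitrary: b rule: less_induct)
  case (less t)
  from less.prems(1) show ?case
  proof (cases rule: blossom_cases)
    case 1
    then have "s < t" using assms(5) by (simp add: S_def)
    moreover have "odd (t - 2)" using \<open>odd t\<close> 1 by simp
    \<comment> \<open>Parity sharpens \<open>s < t\<close> to \<open>s \<le> t - 2\<close>, as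
      monotonicity requires.\<close>
    moreover have "s \<noteq> t - 1" using \<open>odd s\<close> \<open>odd t\<close> by auto
    ultimately have "blossom c s \<subseteq> blossom c (t - 2)"
      using blossom_mono[OF assms(2,3)] by simp
    then show ?thesis
      using blossom_subset_blossom_base[of t c b] 1 assms(2) by blast
  next
    case (2 w)
    then have "blossom c s \<subseteq> blossom w (t - 2)"
      using less.IH[of "t - 2" w] \<open>odd t\<close> by simp
    then show ?thesis using blossom_subset_blossom_base[of t w b] 2 by blast
  next
    case 3
    then have "blossom c s \<subseteq> blossom b (t - 2)"
      using less.IH[of "t - 2" b] \<open>odd t\<close> by simp
    then show ?thesis using blossom_minus_two_subset[of t b] 3 by blast
  qed
qed

lemma common_vertex_imp_bases_related:
  assumes "v \<in> blossom b s" "v \<in> blossom c t"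
  shows "b = c \<or> b \<in> blossom c t \<or> c \<in> blossom b s"
proof -
  obtain k where "0 < k" "(base ^^ k) v = b"
    "\<And>j. 0 < j \<Longrightarrow> j < k \<Longrightarrow> (base ^^ j) v \<in> blossom b s"
    using base_iterates_in_blossom[OF assms(1)] by blast
  moreover obtain l where "0 < l" "(base ^^ l) v = c"
    "\<And>j. 0 < j \<Longrightarrow> j < l \<Longrightarrow> (base ^^ j) v \<in> blossom c t"
    using base_iterates_in_blossom[OF assms(2)] by blast
  \<comment> \<open>If \<open>k < l\<close>, then \<open>b\<close> is an intermediate iterate on the
    way to \<open>c\<close>; \<open>l < k\<close> is symmetric, and \<open>k = l\<close> gives
    \<open>b = c\<close>.\<close>
  ultimately show ?thesis by (metis nat_neq_iff)
qed

lemma blossoms_laminar: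
  assumes "A \<in> blossoms" "B \<in> blossoms"
  shows "A \<inter> B = {} \<or> A \<subseteq> B \<or> B \<subseteq> A"
proof (cases "A \<inter> B = {}")
  case False
  then obtain v where v: "v \<in> A" "v \<in> B" by blast
  obtain b s where b: "A = blossom b s" "outer b" "odd s" "enat s < tenacity b"
    using assms(1) unfolding blossoms_def by blast
  obtain c t where c: "B = blossom c t" "outer c" "odd t" "enat t < tenacity c"
    using assms(2) unfolding blossoms_def by blast
  consider "b = c" | "b \<in> blossom c t" | "c \<in> blossom b s"
    using common_vertex_imp_bases_related v b(1) c(1) by blast
  then show ?thesis
  proof cases
    case 1
    then show ?thesis
      using blossom_mono[of b s t] blossom_mono[of b t s] b c by (cases "s \<le> t") auto
  next
    case 2
    then show ?thesis using blossom_subset_if_base_in_blossom b c by blast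
  next
    case 3
    then show ?thesis using blossom_subset_if_base_in_blossom b c by blast
  qed
qed simp

end

theorem theorem3:
  fixes V :: "'a set" and E M :: "'a set set"
  assumes "matched_graph V E M"
  shows "\<forall>A \<in> matched_graph.blossoms V E M. \<forall>B \<in> matched_graph.blossoms V E M.
           A \<inter> B = {} \<or> A \<subseteq> B \<or> B \<subseteq> A"
  using matched_graph.blossoms_laminar[OF assms] by blast

end
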